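(* For an integer $n\ge 2$, let $J(n,2)$ be the Johnson graph on $\binom{[n]}{2}$. Then \[ \lim_{n\to\infty}\frac{\operatorname{iso}(J(n,2))}{(2-\sqrt{2})\,n}=1, \] that is, $\operatorname{iso}(J(n,2))\sim (2-\sqrt{2})n$.
   Context: For a finite graph $G$ with $N$ vertices and $S\subseteq V(G)$, the boundary $\partial S$ is the set of edges of $G$ with exactly one endpoint in $S$. The isoperimetric number of $G$ is $\operatorname{iso}(G)=\min\{|\partial S|/|S| : S\subseteq V(G),\ 0<|S|\le N/2\}$. For positive integers $k\le n$, the Johnson graph $J(n,k)$ has vertex set $\binom{[n]}{k}$ (all $k$-element subsets of $[n]=\{1,\dots,n\}$), two vertices being adjacent iff their intersection has exactly $k-1$ elements. In particular $J(n,2)$ has $n(n-1)/2$ vertices. *)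

theory Defs
  imports Complex_Main
begin

record 'a ugraph =
  vertices :: "'a set"
  edges :: "'a set set"

definition finite_simple_graph :: "'a ugraph \<Rightarrow> bool" where
  "finite_simple_graph G \<longleftrightarrow>
     finite (vertices G) \<and> (\<forall>e\<in>edges G. e \<subseteq> vertices G \<and> card e = 2)"

definition edge_boundary :: "'a ugraph \<Rightarrow> 'a set \<Rightarrow> 'a set set" where
  "edge_boundary G S = {e \<in> edges G. card (e \<inter> S) = 1}"

definition iso_ratios :: "'a ugraph \<Rightarrow> real set" where
  "iso_ratios G =
     {real (card (edge_boundary G S)) / real (card S) | S.
        S \<subseteq> vertices G \<and> 0 < card S \<and> real (card S) \<le> real (card (vertices G)) / 2}"

text \<open>On a graph with fewer than two vertices no set \<open>S\<close> qualifies and the value below is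
  unspecified; on every finite graph with at least two vertices the minimum is attained.\<close>

definition isoperimetric_number :: "'a ugraph \<Rightarrow> real" where
  "isoperimetric_number G = Min (iso_ratios G)"

lemma finite_iso_ratios:
  assumes "finite (vertices G)"
  shows "finite (iso_ratios G)"
proof -
  have "iso_ratios G \<subseteq>
      (\<lambda>S. real (card (edge_boundary G S)) / real (card S)) ` Pow (vertices G)"
    by (auto simp: iso_ratios_def)
  then show ?thesis
    using assms by (simp add: finite_subset)
qed

lemma iso_ratios_nonempty:
  assumes "2 \<le> card (vertices G)"
  shows "iso_ratios G \<noteq> {}"
proof -
  obtain v where "v \<in> vertices G"
    using assms by fastforce
  then have "real (card (edge_boundary G {v})) / real (card {v}) \<in> iso_ratios G"
    using assms unfolding iso_ratios_def by (intro CollectI exI[of _ "{v}"]) auto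
  then show ?thesis by blast
qed

text \<open>Adjacency is \<open>card (A \<inter> B) = k - 1\<close>, written without truncated subtraction;
  it forces \<open>A \<noteq> B\<close>.\<close>

definition johnson_graph :: "nat \<Rightarrow> nat \<Rightarrow> nat set ugraph" where
  "johnson_graph n k =
     (let V = {A. A \<subseteq> {1..n} \<and> card A = k}
      in \<lparr>vertices = V, edges = {{A, B} | A B. A \<in> V \<and> B \<in> V \<and> card (A \<inter> B) + 1 = k}\<rparr>)"

lemma finite_simple_graph_johnson: "finite_simple_graph (johnson_graph n k)"
proof -
  have "card {A, B} = 2" if "card (A \<inter> B) + 1 = k" "card A = k" for A B :: "nat set"
    using that by (cases "A = B") auto
  then show ?thesis
    by (auto simp: finite_simple_graph_def johnson_graph_def Let_def)
qed

lemma card_vertices_johnson: "card (vertices (johnson_graph n k)) = n choose k"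
  using n_subsets[of "{1..n}" k] by (simp add: johnson_graph_def)

end

theory Submission
  imports Defs "HOL-Real_Asymp.Real_Asymp"
begin

text \<open>
  View a set \<open>S\<close> of vertices of \<open>J(n,2)\<close> as a graph with \<open>e\<close> edges on \<open>n\<close> points. Then
  \<open>|\<partial>S| = 2(n-1)e - P\<close>, where \<open>P\<close> is the sum of the squared degrees, so \<open>P/e\<close> has to be
  maximized subject to \<open>e \<le> n(n-1)/4\<close>. A clique on about \<open>n/\<surd>2\<close> points gives \<open>P/e \<approx> \<surd>2 n\<close>.
  For the converse, replacing an edge \<open>wv\<close> by \<open>wu\<close> with \<open>deg u \<ge> deg v\<close> increases \<open>P\<close>; hence in a
  maximizer, with the points sorted by decreasing degree, the adjacency matrix (with part of the
  diagonal filled in) is a symmetric down-set \<open>R\<close> of the \<open>n \<times> n\<close> grid, and \<open>P\<close> is at most the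
  sum of \<open>2y + 1\<close> over \<open>(x, y) \<in> R\<close>. This sum is at most \<open>k|R|\<close> when \<open>|R| \<le> k\<^sup>2\<close> and
  \<open>k \<approx> n/\<surd>2\<close>: one compares \<open>R\<close> with the square \<open>[0,k)\<^sup>2\<close> or with the complement of \<open>[n-k,n)\<^sup>2\<close>,
  the two asymptotically extremal shapes.
\<close>

section \<open>Symmetric down-sets of the grid\<close>

lemma sum_odd_interval:
  assumes "p \<le> q"
  shows "(\<Sum>y\<in>{p..<q}. 2 * int y + 1) = (int p + int q) * (int q - int p)"
  using assms by (induction q rule: dec_induct) (auto simp: algebra_simps)

text \<open>An initial segment \<open>{p..<r}\<close> has average \<open>p + r\<close>, which is at
  most the average \<open>p + q\<close> of the whole interval.\<close>

lemma sum_initial_segment_le: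
  assumes "X \<subseteq> {p..<q}" and "\<And>y y'. y \<in> X \<Longrightarrow> p \<le> y' \<Longrightarrow> y' \<le> y \<Longrightarrow> y' \<in> X"
  shows "(\<Sum>y\<in>X. 2 * int y + 1) \<le> (int p + int q) * int (card X)"
  using assms
proof (induction q)
  case 0
  then show ?case by simp
next
  case (Suc q)
  show ?case
  proof (cases "q \<in> X")
    case True
    then have "X = {p..<Suc q}"
      using Suc.prems by fastforce
    moreover have "p \<le> Suc q"
      using True Suc.prems(1) by auto
    ultimately show ?thesis
      using sum_odd_interval[of p "Suc q"] by (simp add: of_nat_diff)
  next
    case False
    then have "X \<subseteq> {p..<q}"
      using Suc.prems(1) by (auto simp: less_Suc_eq)
    then have "(\<Sum>y\<in>X. 2 * int y + 1) \<le> (int p + int q) * int (card X)"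
      using Suc by blast
    also have "\<dots> \<le> (int p + int (Suc q)) * int (card X)"
      by (intro mult_right_mono) auto
    finally show ?thesis .
  qed
qed

text \<open>The complement in \<open>{p..<q}\<close> is an initial segment, whose average is at most
  that of the interval; removing it cannot lower the average.\<close>

lemma sum_final_segment_ge:
  assumes "X \<subseteq> {p..<q}" and "\<And>y y'. y \<in> X \<Longrightarrow> y \<le> y' \<Longrightarrow> y' < q \<Longrightarrow> y' \<in> X"
  shows "(int p + int q) * int (card X) \<le> (\<Sum>y\<in>X. 2 * int y + 1)"
proof (cases "p \<le> q")
  case True
  let ?Y = "{p..<q} - X"
  have "(\<Sum>y\<in>?Y. 2 * int y + 1) \<le> (int p + int q) * int (card ?Y)"
    by (rule sum_initial_segment_le) (use assms(2) in force)+
  moreover have "(\<Sum>y\<in>?Y. 2 * int y + 1) = (\<Sum>y\<in>{p..<q}. 2 * int y + 1) - (\<Sum>y\<in>X. 2 * int y + 1)"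
    using assms(1) by (intro sum_diff) auto
  moreover have "int (card ?Y) = int q - int p - int (card X)"
    using assms(1) True card_mono[OF _ assms(1)]
    by (simp add: card_Diff_subset finite_subset of_nat_diff)
  ultimately show ?thesis
    using sum_odd_interval[OF True] by (simp add: algebra_simps)
next
  case False
  then show ?thesis using assms(1) by simp
qed

text \<open>The sum is smallest for the first \<open>card X\<close> naturals, where the odd numbers
  add up to a square. The induction removes the maximum, which is at least
  \<open>card X - 1\<close>.\<close>

lemma sum_square_le:
  assumes "finite X"
  shows "int (card X) ^ 2 \<le> (\<Sum>y\<in>X. 2 * int y + 1)"
  using assms
proof (induction "card X" arbitrary: X)
  case 0
  then show ?case by simp
next
  case (Suc m)
  then have ne: "X \<noteq> {}" by auto
  define t where "t = Max X"
  have t: "t \<in> X" "X \<subseteq> {..t}"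
    using Suc.prems ne by (auto simp: t_def)
  have "card X \<le> Suc t"
    using card_mono[OF _ t(2)] by simp
  moreover have "int (card (X - {t})) ^ 2 \<le> (\<Sum>y\<in>X - {t}. 2 * int y + 1)"
    using Suc t by (intro Suc.hyps(1)) auto
  moreover have "(\<Sum>y\<in>X. 2 * int y + 1) = 2 * int t + 1 + (\<Sum>y\<in>X - {t}. 2 * int y + 1)"
    using Suc.prems t(1) by (simp add: sum.remove)
  moreover have "card X = Suc m" "card (X - {t}) = m"
    using Suc t by auto
  ultimately show ?case
    by (simp add: power2_eq_square algebra_simps)
qed

text \<open>A row \<open>[0, d)\<close> contributes \<open>d^2\<close>, so a set with such rows
  weighs the sum of its squared row lengths. Spreading this over the cells as odd numbers makes it
  additive over disjoint unions, so that shapes can be cut and compared block by block.\<close>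

definition weight :: "(nat \<times> nat) set \<Rightarrow> int" where
  "weight R = (\<Sum>(x, y)\<in>R. 2 * int y + 1)"

lemma weight_Image:
  assumes "finite X" "finite Y" "D \<subseteq> X \<times> Y"
  shows "weight D = (\<Sum>x\<in>X. \<Sum>y\<in>D `` {x}. 2 * int y + 1)"
    and "card D = (\<Sum>x\<in>X. card (D `` {x}))"
proof -
  have D: "D = Sigma X (\<lambda>x. D `` {x})"
    using assms(3) by auto
  have fin: "finite (D `` {x})" for x
    using assms by (intro finite_Image) (auto intro: finite_subset)
  show "weight D = (\<Sum>x\<in>X. \<Sum>y\<in>D `` {x}. 2 * int y + 1)"
    unfolding weight_def by (subst D, subst sum.Sigma) (use assms(1) fin in auto)
  show "card D = (\<Sum>x\<in>X. card (D `` {x}))"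
    by (subst D, subst card_SigmaI) (use assms(1) fin in auto)
qed

lemma weight_le:
  assumes "finite X" "D \<subseteq> X \<times> {p..<q}"
    and "\<And>x y y'. (x, y) \<in> D \<Longrightarrow> p \<le> y' \<Longrightarrow> y' \<le> y \<Longrightarrow> (x, y') \<in> D"
  shows "weight D \<le> (int p + int q) * int (card D)"
proof -
  have "weight D = (\<Sum>x\<in>X. \<Sum>y\<in>D `` {x}. 2 * int y + 1)"
    using assms by (intro weight_Image) auto
  also have "\<dots> \<le> (\<Sum>x\<in>X. (int p + int q) * int (card (D `` {x})))"
    using assms by (intro sum_mono sum_initial_segment_le) auto
  also have "\<dots> = (int p + int q) * int (card D)"
    using weight_Image(2)[of X "{p..<q}" D] assms by (simp add: sum_distrib_left)
  finally show ?thesis .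
qed

lemma weight_ge:
  assumes "finite X" "D \<subseteq> X \<times> {p..<q}"
    and "\<And>x y y'. (x, y) \<in> D \<Longrightarrow> y \<le> y' \<Longrightarrow> y' < q \<Longrightarrow> (x, y') \<in> D"
  shows "(int p + int q) * int (card D) \<le> weight D"
proof -
  have "(int p + int q) * int (card D) = (\<Sum>x\<in>X. (int p + int q) * int (card (D `` {x})))"
    using weight_Image(2)[of X "{p..<q}" D] assms by (simp add: sum_distrib_left)
  also have "\<dots> \<le> (\<Sum>x\<in>X. \<Sum>y\<in>D `` {x}. 2 * int y + 1)"
    using assms by (intro sum_mono sum_final_segment_ge) auto
  also have "\<dots> = weight D"
    using assms by (intro weight_Image(1)[symmetric]) auto
  finally show ?thesis .
qed

lemma weight_box:
  assumes "finite X" "p \<le> q"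
  shows "weight (X \<times> {p..<q}) = (int p + int q) * int (card (X \<times> {p..<q}))"
  using weight_le[of X "X \<times> {p..<q}" p q] weight_ge[of X "X \<times> {p..<q}" p q] assms(1)
  by fastforce

lemma weight_Un_disjoint:
  "finite A \<Longrightarrow> finite B \<Longrightarrow> A \<inter> B = {} \<Longrightarrow> weight (A \<union> B) = weight A + weight B"
  unfolding weight_def by (rule sum.union_disjoint)

lemma downset_row:
  fixes R :: "(nat \<times> nat) set"
  assumes "finite R" and "\<And>x y y'. (x, y) \<in> R \<Longrightarrow> y' \<le> y \<Longrightarrow> (x, y') \<in> R"
  obtains b where "\<And>y. (x, y) \<in> R \<longleftrightarrow> y < b"
proof -
  have "finite (R `` {x})"
    using assms(1) by (rule finite_Image)
  then have "\<exists>y. (x, y) \<notin> R"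
    by (metis Image_singleton_iff ex_new_if_finite infinite_UNIV_nat)
  then have "(x, y) \<in> R \<longleftrightarrow> y < (LEAST y. (x, y) \<notin> R)" for y
    using LeastI_ex[of "\<lambda>y. (x, y) \<notin> R"] not_less_Least[of y "\<lambda>y. (x, y) \<notin> R"] assms(2)[of x y]
    by (meson not_less)
  then show thesis by (rule that)
qed

section \<open>The weight inequality for symmetric down-sets\<close>

locale sym_downset =
  fixes R :: "(nat \<times> nat) set" and n :: nat
  assumes bounded: "R \<subseteq> {..<n} \<times> {..<n}"
    and sym: "(x, y) \<in> R \<Longrightarrow> (y, x) \<in> R"
    and down_snd: "(x, y) \<in> R \<Longrightarrow> y' \<le> y \<Longrightarrow> (x, y') \<in> R"
begin

lemma finite_R: "finite R"
  using bounded by (rule finite_subset) auto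

lemma down: "(x, y) \<in> R \<Longrightarrow> x' \<le> x \<Longrightarrow> y' \<le> y \<Longrightarrow> (x', y') \<in> R"
  by (meson down_snd sym)

lemma row:
  obtains b where "\<And>y. (x, y) \<in> R \<longleftrightarrow> y < b"
  using downset_row[of R x] finite_R down_snd by blast

text \<open>If \<open>(i, i)\<close> and \<open>(j, j)\<close> lie in \<open>R\<close>, the one with
  the larger index dominates \<open>(i, j)\<close>; so the square of the index set lies in
  \<open>R\<close>.\<close>

lemma diagonal_square_le: "card {i. (i, i) \<in> R} ^ 2 \<le> card R"
proof -
  let ?I = "{i. (i, i) \<in> R}"
  have "(i, j) \<in> R" if "i \<in> ?I" "j \<in> ?I" for i j
    using that down[of i i i j] down[of j j i j] by (cases "j \<le> i") auto
  then have "?I \<times> ?I \<subseteq> R" by auto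
  then have "card (?I \<times> ?I) \<le> card R"
    using finite_R by (rule card_mono[rotated])
  then show ?thesis
    by (simp add: card_cartesian_product power2_eq_square)
qed

text \<open>The square \<open>[0, k)^2\<close> gives equality, and the complement of
  \<open>[a, n)^2\<close> with \<open>a = n - k\<close> misses it by \<open>a (2k^2 - n^2)\<close>
  only. In the first two cases \<open>R\<close> arises from one of these shapes by adding and
  removing blocks inside boxes: box averages bound the weights of the blocks, and the bound on
  \<open>card R\<close> limits what is added in terms of what is removed.\<close>

lemma weight_le_card:
  assumes k: "n\<^sup>2 \<le> 2 * k\<^sup>2" "4 * k \<le> 3 * n" and card: "card R \<le> k\<^sup>2"
  shows "weight R \<le> int k * int (card R)"
proof -
  define a where "a = n - k"
  have kn: "k \<le> n" and n: "n = a + k" "int n = int a + int k"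
    using k(2) by (auto simp: a_def)
  have na: "n - a = k" "a \<le> n"
    using kn by (auto simp: a_def)
  have k34: "4 * int k \<le> 3 * int n"
    using k(2) by linarith
  have ak: "a \<le> k"
  proof (rule ccontr)
    assume "\<not> a \<le> k"
    then have "2 * k < n" using n by simp
    then have "(2 * k)\<^sup>2 < n\<^sup>2" by (intro power_strict_mono) auto
    then show False using k(1) by (simp add: power_mult_distrib)
  qed
  have kint: "(int n)\<^sup>2 \<le> 2 * (int k)\<^sup>2"
    using of_nat_mono[OF k(1), where 'a = int] by simp
  have cardint: "int (card R) \<le> (int k)\<^sup>2"
    using of_nat_mono[OF card, where 'a = int] by simp
  show ?thesis
  \<comment> \<open>The cell \<open>(k, a)\<close> decides the reference shape. If it is present,
    \<open>R\<close> is compared with the square \<open>?Q\<close>: \<open>?E\<close> is missing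
    from the square, while \<open>?B\<close> and its converse stick out.\<close>
  proof (cases "(k, a) \<in> R")
    case True
    obtain b where b: "\<And>y. (k, y) \<in> R \<longleftrightarrow> y < b"
      using row by blast
    have "(k, k) \<notin> R"
    proof
      assume "(k, k) \<in> R"
      then have "{..k} \<times> {..k} \<subseteq> R" using down by auto
      then have "card ({..k} \<times> {..k}) \<le> card R"
        using finite_R by (rule card_mono[rotated])
      then show False
        using card by (simp add: card_cartesian_product power2_eq_square)
    qed
    then have bk: "b \<le> k" and ab: "a < b" using b True by auto
    let ?Q = "{0..<k} \<times> {0..<k}"
    let ?E = "?Q - R"
    let ?B = "{(x, y) \<in> R. k \<le> x}"
    have fin: "finite ?B" "finite (?B\<inverse>)" "finite ?E" "finite (?Q \<inter> R)"
      using finite_R by (auto intro: finite_subset[OF _ finite_R])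
    have B: "?B \<subseteq> {k..<n} \<times> {0..<b}"
      using bounded b down by fastforce
    have R: "R = (?Q \<inter> R) \<union> (?B \<union> ?B\<inverse>)"
      using sym B bk by fastforce
    have disj: "(?Q \<inter> R) \<inter> (?B \<union> ?B\<inverse>) = {}" "?B \<inter> ?B\<inverse> = {}"
      using B bk by fastforce+
    have Q: "?Q = (?Q \<inter> R) \<union> ?E" "(?Q \<inter> R) \<inter> ?E = {}" by auto
    \<comment> \<open>A cell \<open>(x, y)\<close> of \<open>?Q\<close> with \<open>x < b\<close> is
      dominated, up to symmetry, by the cell \<open>(k, x)\<close> of \<open>R\<close>; likewise for
      \<open>y\<close>.\<close>
    have E: "?E \<subseteq> {b..<k} \<times> {b..<k}"
    proof clarify
      fix x y
      assume xy: "x \<in> {0..<k}" "y \<in> {0..<k}" "(x, y) \<notin> R"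
      then have "(k, x) \<notin> R" "(k, y) \<notin> R"
        using down sym by (meson atLeastLessThan_iff less_imp_le order_refl)+
      then show "x \<in> {b..<k} \<and> y \<in> {b..<k}"
        using b xy by auto
    qed
    have wB: "weight ?B \<le> int b * int (card ?B)"
    proof -
      have "weight ?B \<le> (int 0 + int b) * int (card ?B)"
        by (rule weight_le[OF _ B]) (simp, use down_snd in blast)
      then show ?thesis by simp
    qed
    have wB': "weight (?B\<inverse>) \<le> (int k + int n) * int (card ?B)"
    proof -
      have "?B\<inverse> \<subseteq> {0..<b} \<times> {k..<n}" using B by blast
      then have "weight (?B\<inverse>) \<le> (int k + int n) * int (card (?B\<inverse>))"
        by (rule weight_le[rotated]) (use down in blast, simp)
      then show ?thesis by simp
    qed
    have wE: "(int b + int k) * int (card ?E) \<le> weight ?E"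
      by (rule weight_ge[OF _ E]) (simp, use down_snd in force)
    have wQ: "weight ?Q = int k * (int k)\<^sup>2"
      using weight_box[of "{0..<k}" 0 k] by (simp add: power2_eq_square)
    have "weight R = weight (?Q \<inter> R) + (weight ?B + weight (?B\<inverse>))"
      using fin disj by (subst R) (simp only: weight_Un_disjoint finite_UnI)
    moreover have "weight ?Q = weight (?Q \<inter> R) + weight ?E"
      using fin Q(2) by (subst Q(1)) (simp only: weight_Un_disjoint)
    ultimately have w: "weight R = weight ?Q - weight ?E + weight ?B + weight (?B\<inverse>)"
      by simp
    have "card R = card (?Q \<inter> R) + (card ?B + card (?B\<inverse>))"
      using fin disj by (subst R) (simp only: card_Un_disjoint finite_UnI)
    moreover have "card ?Q = card (?Q \<inter> R) + card ?E"
      using fin Q(2) by (subst Q(1)) (simp only: card_Un_disjoint)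
    ultimately have c: "int (card R) = (int k)\<^sup>2 - int (card ?E) + 2 * int (card ?B)"
      by (simp add: power2_eq_square flip: of_nat_mult)
    \<comment> \<open>What remains is \<open>(a + b) |B| \<le> b |E|\<close>. The bound on
      \<open>card R\<close> gives \<open>2 |B| \<le> |E|\<close>, and \<open>a < b\<close> does the
      rest.\<close>
    have "2 * (int b * int (card ?B)) \<le> int b * int (card ?E)"
      using c cardint mult_left_mono[of "2 * int (card ?B)" "int (card ?E)" "int b"] by simp
    moreover have "(int a + int b) * int (card ?B) \<le> (2 * int b) * int (card ?B)"
      using ab by (intro mult_right_mono) auto
    ultimately show ?thesis
      using w wB wB' wE wQ unfolding c n(2) by (simp add: algebra_simps)
  next
    case nka: False
    \<comment> \<open>By symmetry \<open>(a, k) \<notin> R\<close>, so row \<open>a\<close> has length at most \<open>k\<close>. If \<open>(a, a) \<notin> R\<close>, the comparison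
      shape below is the L-shape of width \<open>s \<le> a\<close>, for the largest square \<open>[0,s)\<^sup>2 \<subseteq> R\<close>.\<close>
    show ?thesis
    proof (cases "(a, a) \<in> R")
      case True
      obtain e where e: "\<And>y. (a, y) \<in> R \<longleftrightarrow> y < e"
        using row by blast
      have ae: "a < e" and ek: "e \<le> k"
        using True nka e sym by (auto simp: not_less[symmetric])
      \<comment> \<open>The reference shape is now the complement of \<open>?H\<close> in
        \<open>?N\<close>: \<open>?F\<close> sticks out of it, while \<open>?D\<close> and its
        converse are missing.\<close>
      let ?N = "{0..<n} \<times> {0..<n}"
      let ?H = "{a..<n} \<times> {a..<n}"
      let ?F = "R \<inter> ?H"
      let ?D = "{(x, y) \<in> ?N - R. y < a}"
      let ?L = "(?N - ?H) \<inter> R"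
      have fin: "finite ?D" "finite (?D\<inverse>)" "finite ?F" "finite ?L" "finite ?H"
        using finite_R by (auto intro: finite_subset[of _ ?N])
      have F: "?F \<subseteq> {a..<e} \<times> {a..<e}"
      proof clarify
        fix x y
        assume xy: "(x, y) \<in> R" "x \<in> {a..<n}" "y \<in> {a..<n}"
        then have "(a, y) \<in> R" "(a, x) \<in> R"
          using down[OF xy(1)] down[OF sym[OF xy(1)]] by auto
        then show "x \<in> {a..<e} \<and> y \<in> {a..<e}"
          using e xy by auto
      qed
      have D: "?D \<subseteq> {e..<n} \<times> {0..<a}"
      proof clarify
        fix x y
        assume xy: "x \<in> {0..<n}" "y \<in> {0..<n}" "(x, y) \<notin> R" "y < a"
        then have "(a, x) \<notin> R"
          using down sym by (meson less_imp_le order_refl)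
        then show "x \<in> {e..<n} \<and> y \<in> {0..<a}"
          using e xy by auto
      qed
      have R: "R = ?L \<union> ?F" "?L \<inter> ?F = {}"
        using bounded by auto
      have N: "?N = ?L \<union> (?H \<union> (?D \<union> ?D\<inverse>))"
        using sym n by auto
      have disj: "?L \<inter> (?H \<union> (?D \<union> ?D\<inverse>)) = {}" "?H \<inter> (?D \<union> ?D\<inverse>) = {}" "?D \<inter> ?D\<inverse> = {}"
        using D ae sym by fastforce+
      have wF: "weight ?F \<le> (int a + int e) * int (card ?F)"
        by (rule weight_le[OF _ F]) (simp, use down_snd bounded in force)
      have wD: "int a * int (card ?D) \<le> weight ?D"
      proof -
        have "(int 0 + int a) * int (card ?D) \<le> weight ?D"
          by (rule weight_ge[OF _ D]) (simp, use down_snd n in force)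
        then show ?thesis by simp
      qed
      have wD': "(int e + int n) * int (card ?D) \<le> weight (?D\<inverse>)"
      proof -
        have "?D\<inverse> \<subseteq> {0..<a} \<times> {e..<n}" using D by blast
        then have "(int e + int n) * int (card (?D\<inverse>)) \<le> weight (?D\<inverse>)"
          by (rule weight_ge[rotated]) (use down in force, simp)
        then show ?thesis by simp
      qed
      have wN: "weight ?N = int n * (int n)\<^sup>2"
        using weight_box[of "{0..<n}" 0 n] by (simp add: power2_eq_square)
      have wH: "weight ?H = (int a + int n) * (int k)\<^sup>2"
        using weight_box[of "{a..<n}" a n] na by (simp add: power2_eq_square)
      have "weight R = weight ?L + weight ?F"
        using fin R(2) by (subst R(1)) (simp only: weight_Un_disjoint)
      moreover have "weight ?N = weight ?L + (weight ?H + (weight ?D + weight (?D\<inverse>)))"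
        using fin disj by (subst N) (simp only: weight_Un_disjoint finite_UnI)
      ultimately have w: "weight R = weight ?N - weight ?H - weight ?D - weight (?D\<inverse>) + weight ?F"
        by simp
      have "card R = card ?L + card ?F"
        using fin R(2) by (subst R(1)) (simp only: card_Un_disjoint)
      moreover have "card ?N = card ?L + (card ?H + (card ?D + card (?D\<inverse>)))"
        using fin disj by (subst N) (simp only: card_Un_disjoint finite_UnI)
      moreover have "card ?H = k * k" "card ?N = n * n"
        using na by (simp_all add: card_cartesian_product)
      ultimately have c: "int (card R) = (int n)\<^sup>2 - (int k)\<^sup>2 - 2 * int (card ?D) + int (card ?F)"
        by (simp add: power2_eq_square flip: of_nat_mult)
      \<comment> \<open>The excess of \<open>weight R\<close> over \<open>k |R|\<close> is at most
        \<open>a (n^2 - 2k^2) + (a + e - k) |F| - (a + e + n - 2k) |D|\<close>. A common multiplier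
        \<open>M \<ge> 0\<close> replaces the two coefficients by \<open>M\<close> and
        \<open>2M\<close>, so that the bound on \<open>|F| - 2 |D|\<close> coming from
        \<open>card R\<close> can be used. When the maximum is 0, the inequality for
        \<open>2M\<close> rests on \<open>4k \<le> 3n\<close>.\<close>
      define M where "M = max 0 (int a + int e - int k)"
      have M: "0 \<le> M" "int a + int e - int k \<le> M" "M \<le> int a"
        "2 * M \<le> int a + int e + int n - 2 * int k"
        using ae ek n(2) k34 by (auto simp: M_def max_def)
      have "(int a + int e - int k) * int (card ?F) \<le> M * int (card ?F)"
        using M by (intro mult_right_mono) auto
      moreover have "2 * M * int (card ?D) \<le> (int a + int e + int n - 2 * int k) * int (card ?D)"
        using M by (intro mult_right_mono) auto
      moreover have "M * (int (card ?F) - 2 * int (card ?D)) \<le> M * (2 * (int k)\<^sup>2 - (int n)\<^sup>2)"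
        using c cardint M by (intro mult_left_mono) auto
      moreover have "M * (2 * (int k)\<^sup>2 - (int n)\<^sup>2) \<le> int a * (2 * (int k)\<^sup>2 - (int n)\<^sup>2)"
        using M kint by (intro mult_right_mono) auto
      moreover have "int n * (int n)\<^sup>2 - (int a + int n) * (int k)\<^sup>2 - int k * ((int n)\<^sup>2 - (int k)\<^sup>2)
          = int a * ((int n)\<^sup>2 - 2 * (int k)\<^sup>2)"
        unfolding n(2) by (simp add: power2_eq_square algebra_simps)
      ultimately show ?thesis
        using w wF wD wD' wN wH unfolding c by (simp add: algebra_simps)
    next
      case False
      define s where "s = (LEAST i. (i, i) \<notin> R)"
      have ss: "(s, s) \<notin> R" and sa: "s \<le> a"
        using False LeastI[of "\<lambda>i. (i, i) \<notin> R" a] Least_le[of "\<lambda>i. (i, i) \<notin> R" a]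
        unfolding s_def by auto
      have less_s: "(i, i) \<in> R" if "i < s" for i
        using that not_less_Least unfolding s_def by blast
      let ?Q = "{0..<s} \<times> {0..<s}"
      let ?A = "{(x, y) \<in> R. s \<le> x}"
      have A: "?A \<subseteq> {s..<n} \<times> {0..<s}"
      proof clarify
        fix x y assume xy: "(x, y) \<in> R" "s \<le> x"
        then have "y < s" using ss down[of x y s s] by (meson not_less)
        then show "x \<in> {s..<n} \<and> y \<in> {0..<s}" using xy bounded by auto
      qed
      have fin: "finite ?A" "finite (?A\<inverse>)" "finite ?Q"
        using finite_R by (auto intro: finite_subset[OF _ finite_R])
      have Q: "?Q \<subseteq> R"
      proof clarify
        fix x y assume "x \<in> {0..<s}" "y \<in> {0..<s}"
        then have "max x y < s" by auto
        then show "(x, y) \<in> R" using less_s down by (meson max.cobounded1 max.cobounded2)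
      qed
      have R: "R = ?Q \<union> (?A \<union> ?A\<inverse>)"
      proof (intro equalityI subsetI)
        fix z assume z: "z \<in> R"
        obtain x y where "z = (x, y)" by (cases z)
        then show "z \<in> ?Q \<union> (?A \<union> ?A\<inverse>)"
          using z sym[of x y] by (cases "s \<le> x"; cases "s \<le> y") auto
      qed (use sym Q in auto)
      have disj: "?Q \<inter> (?A \<union> ?A\<inverse>) = {}" "?A \<inter> ?A\<inverse> = {}"
        using A by fastforce+
      have wA: "weight ?A \<le> int s * int (card ?A)"
        proof -
        have "weight ?A \<le> (int 0 + int s) * int (card ?A)"
          by (rule weight_le[OF _ A]) (simp, use down_snd in blast)
        then show ?thesis by simp
      qed
      have wA': "weight (?A\<inverse>) \<le> (int s + int n) * int (card ?A)"
      proof -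
        have "?A\<inverse> \<subseteq> {0..<s} \<times> {s..<n}" using A by blast
        then have "weight (?A\<inverse>) \<le> (int s + int n) * int (card (?A\<inverse>))"
          by (rule weight_le[rotated]) (use down in blast, simp)
        then show ?thesis by simp
      qed
      have wQ: "weight ?Q = int s * (int s)\<^sup>2"
        using weight_box[of "{0..<s}" 0 s] by (simp add: power2_eq_square)
      have w: "weight R = weight ?Q + (weight ?A + weight (?A\<inverse>))"
        using fin disj by (subst R) (simp only: weight_Un_disjoint finite_UnI)
      have "card R = card ?Q + (card ?A + card (?A\<inverse>))"
        using fin disj by (subst R) (simp only: card_Un_disjoint finite_UnI)
      then have c: "int (card R) = (int s)\<^sup>2 + 2 * int (card ?A)"
        by (simp add: power2_eq_square)
      have "card ?A \<le> (n - s) * s"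
        using card_mono[OF _ A] by (simp add: card_cartesian_product)
      then have "int (card ?A) \<le> int ((n - s) * s)"
        by (simp only: of_nat_le_iff)
      moreover have "s \<le> n" using sa na by linarith
      ultimately have cA: "int (card ?A) \<le> (int n - int s) * int s"
        by (simp add: of_nat_diff)
      have "weight R - int k * int (card R)
          \<le> int s * (int s * (int s - int k)) + (2 * int s + int n - 2 * int k) * int (card ?A)"
        using w wQ wA wA' unfolding c by (simp add: algebra_simps power2_eq_square)
      also have "\<dots> \<le> 0"
      \<comment> \<open>If the coefficient of \<open>|A|\<close> is positive, \<open>|A|\<close> may
        be replaced by the area of its box, that is, \<open>R\<close> by the full L-shape; the
        resulting polynomial factors, with \<open>a - s \<ge> 0\<close> and
        \<open>n^2 \<le> 2k^2\<close> giving its sign.\<close>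
      proof (cases "2 * int s + int n - 2 * int k \<le> 0")
        case True
        then have "(2 * int s + int n - 2 * int k) * int (card ?A) \<le> 0"
          by (simp add: mult_nonpos_nonneg)
        moreover have "int s * (int s * (int s - int k)) \<le> 0"
          using sa ak by (simp add: mult_nonneg_nonpos)
        ultimately show ?thesis by simp
      next
        case False
        then have "(2 * int s + int n - 2 * int k) * int (card ?A)
            \<le> (2 * int s + int n - 2 * int k) * ((int n - int s) * int s)"
          using cA by (intro mult_left_mono) auto
        moreover have "int s * (int s * (int s - int k))
            + (2 * int s + int n - 2 * int k) * ((int n - int s) * int s)
          = int s * (((int n)\<^sup>2 - 2 * (int k)\<^sup>2) - (int a - int s) * (2 * int k - int s))"
          unfolding n(2) by (simp add: power2_eq_square algebra_simps)
        moreover have "0 \<le> (int a - int s) * (2 * int k - int s)"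
          using sa ak by simp
        then have "int s * (((int n)\<^sup>2 - 2 * (int k)\<^sup>2) - (int a - int s) * (2 * int k - int s)) \<le> 0"
          using kint by (intro mult_nonneg_nonpos) auto
        ultimately show ?thesis by linarith
      qed
      finally show ?thesis by simp
    qed
  qed
qed

end

section \<open>Sums of squared degrees\<close>

abbreviation pairs :: "nat \<Rightarrow> nat set set" where
  "pairs n \<equiv> {A. A \<subseteq> {1..n} \<and> card A = 2}"

definition vdeg :: "nat set set \<Rightarrow> nat \<Rightarrow> nat" where
  "vdeg S v = card {A \<in> S. v \<in> A}"

definition sumsq :: "nat \<Rightarrow> nat set set \<Rightarrow> nat" where
  "sumsq n S = (\<Sum>v\<in>{1..n}. (vdeg S v)\<^sup>2)"

lemma finite_pairs: "finite (pairs n)"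
  by (rule finite_subset[of _ "Pow {1..n}"]) auto

lemma finite_subset_pairs: "S \<subseteq> pairs n \<Longrightarrow> finite S"
  using finite_pairs by (rule rev_finite_subset)

lemma card_2_mem: "card A = 2 \<Longrightarrow> v \<in> A \<Longrightarrow> \<exists>u. u \<noteq> v \<and> A = {v, u}"
  by (auto simp: card_2_iff)

lemma vdeg_eq_sum: "finite S \<Longrightarrow> vdeg S v = (\<Sum>A\<in>S. of_bool (v \<in> A))"
  by (simp add: vdeg_def Int_def)

text \<open>Double counting of the triples \<open>(v, A, B)\<close> with
  \<open>v \<in> A \<inter> B\<close>.\<close>

lemma sum_vdeg_mult:
  assumes "S \<subseteq> pairs n" "finite T"
  shows "(\<Sum>v\<in>{1..n}. vdeg S v * vdeg T v) = (\<Sum>A\<in>S. \<Sum>B\<in>T. card (A \<inter> B))"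
proof -
  have S: "finite S" using assms(1) by (rule finite_subset_pairs)
  have "(\<Sum>v\<in>{1..n}. vdeg S v * vdeg T v)
      = (\<Sum>v\<in>{1..n}. \<Sum>A\<in>S. \<Sum>B\<in>T. of_bool (v \<in> A \<inter> B))"
    by (simp only: vdeg_eq_sum[OF S] vdeg_eq_sum[OF assms(2)] sum_product Int_iff of_bool_conj)
  also have "\<dots> = (\<Sum>A\<in>S. \<Sum>v\<in>{1..n}. \<Sum>B\<in>T. of_bool (v \<in> A \<inter> B))"
    by (rule sum.swap)
  also have "\<dots> = (\<Sum>A\<in>S. \<Sum>B\<in>T. \<Sum>v\<in>{1..n}. of_bool (v \<in> A \<inter> B))"
    by (intro sum.cong refl sum.swap)
  also have "\<dots> = (\<Sum>A\<in>S. \<Sum>B\<in>T. card (A \<inter> B))"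
  proof (intro sum.cong refl)
    fix A B assume "A \<in> S"
    then have "{1..n} \<inter> {v. v \<in> A \<inter> B} = A \<inter> B" using assms(1) by auto
    then show "(\<Sum>v\<in>{1..n}. of_bool (v \<in> A \<inter> B)) = card (A \<inter> B)"
      by (subst sum_of_bool_eq) simp_all
  qed
  finally show ?thesis .
qed

lemma sum_vdeg:
  assumes "S \<subseteq> pairs n"
  shows "(\<Sum>v\<in>{1..n}. vdeg S v) = 2 * card S"
proof -
  \<comment> \<open>The one-member family \<open>{{1..n}}\<close> has degree 1 at every point, which
    makes the handshake identity an instance of the double count.\<close>
  have "(\<Sum>v\<in>{1..n}. vdeg S v) = (\<Sum>v\<in>{1..n}. vdeg S v * vdeg {{1..n}} v)"
    by (intro sum.cong) (auto simp: vdeg_def Collect_conv_if)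
  also have "\<dots> = (\<Sum>A\<in>S. card (A \<inter> {1..n}))"
    using sum_vdeg_mult[OF assms, of "{{1..n}}"] by simp
  also have "\<dots> = (\<Sum>A\<in>S. 2)"
    using assms by (intro sum.cong) (auto simp: Int_absorb2)
  finally show ?thesis by simp
qed

lemma vdeg_pairs:
  assumes "v \<in> {1..n}"
  shows "vdeg (pairs n) v = n - 1"
proof -
  have "bij_betw (\<lambda>u. {v, u}) ({1..n} - {v}) {A \<in> pairs n. v \<in> A}"
  proof (rule bij_betw_imageI)
    show "inj_on (\<lambda>u. {v, u}) ({1..n} - {v})"
      by (auto simp: inj_on_def doubleton_eq_iff)
    show "(\<lambda>u. {v, u}) ` ({1..n} - {v}) = {A \<in> pairs n. v \<in> A}"
      using assms by (auto dest!: card_2_mem)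
  qed
  then have "vdeg (pairs n) v = card ({1..n} - {v})"
    unfolding vdeg_def by (rule bij_betw_same_card[symmetric])
  then show ?thesis using assms by simp
qed

text \<open>A boundary edge is a choice of \<open>A\<close> in \<open>S\<close> and \<open>B\<close>
  outside with \<open>card (A \<inter> B) = 1\<close>. Distinct 2-sets meet in at most one point, so
  the count is the sum of \<open>card (A \<inter> B)\<close>, hence a sum of products of degrees;
  the complementary family has degree \<open>n - 1 - vdeg S v\<close>.\<close>

lemma card_edge_boundary_johnson:
  assumes S: "S \<subseteq> pairs n"
  shows "int (card (edge_boundary (johnson_graph n 2) S))
    = 2 * (int n - 1) * int (card S) - int (sumsq n S)"
proof -
  let ?T = "pairs n - S"
  let ?P = "{(A, B) \<in> S \<times> ?T. card (A \<inter> B) = 1}"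
  have fin: "finite S" "finite ?T"
    using S finite_subset_pairs finite_pairs by auto
  have edges: "edges (johnson_graph n 2)
      = {{A, B} | A B. A \<in> pairs n \<and> B \<in> pairs n \<and> card (A \<inter> B) = 1}"
    by (simp add: johnson_graph_def)
  have "bij_betw (\<lambda>(A, B). {A, B}) ?P (edge_boundary (johnson_graph n 2) S)"
  proof (rule bij_betw_imageI)
    show "inj_on (\<lambda>(A, B). {A, B}) ?P"
      by (auto simp: inj_on_def doubleton_eq_iff)
    show "(\<lambda>(A, B). {A, B}) ` ?P = edge_boundary (johnson_graph n 2) S"
    proof (intro equalityI subsetI)
      fix e assume "e \<in> (\<lambda>(A, B). {A, B}) ` ?P"
      then obtain A B where AB: "e = {A, B}" "A \<in> S" "B \<in> ?T" "card (A \<inter> B) = 1" by auto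
      then have "e \<inter> S = {A}" by auto
      then show "e \<in> edge_boundary (johnson_graph n 2) S"
        using AB S unfolding edge_boundary_def edges by auto
    next
      fix e assume "e \<in> edge_boundary (johnson_graph n 2) S"
      then obtain A B where e: "e = {A, B}" "A \<in> pairs n" "B \<in> pairs n" "card (A \<inter> B) = 1"
        and 1: "card (e \<inter> S) = 1"
        unfolding edge_boundary_def edges by auto
      have "A \<noteq> B" using e by auto
      then have "A \<in> S \<and> B \<notin> S \<or> B \<in> S \<and> A \<notin> S"
        using 1 e(1) by (cases "A \<in> S"; cases "B \<in> S") auto
      then show "e \<in> (\<lambda>(A, B). {A, B}) ` ?P"
      proof
        assume "A \<in> S \<and> B \<notin> S"
        then have "(A, B) \<in> ?P" using e by auto
        then show ?thesis by (rule rev_image_eqI) (simp add: e(1))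
      next
        assume "B \<in> S \<and> A \<notin> S"
        then have "(B, A) \<in> ?P" using e by (auto simp: Int_commute)
        then show ?thesis by (rule rev_image_eqI) (simp add: e(1) insert_commute)
      qed
    qed
  qed
  then have "card (edge_boundary (johnson_graph n 2) S) = card ?P"
    by (rule bij_betw_same_card[symmetric])
  also have "\<dots> = (\<Sum>z\<in>S \<times> ?T. of_bool (case z of (A, B) \<Rightarrow> card (A \<inter> B) = 1))"
    using fin by (subst sum_of_bool_eq) (auto intro!: arg_cong[where f = card])
  also have "\<dots> = (\<Sum>(A, B)\<in>S \<times> ?T. card (A \<inter> B))"
  proof (intro sum.cong refl)
    fix z assume "z \<in> S \<times> ?T"
    then obtain A B where z: "z = (A, B)" and AB: "A \<in> S" "B \<notin> S" "card A = 2" "card B = 2"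
      using S by auto
    have fin: "finite A" "finite B" using AB(3,4) by (simp_all add: card_ge_0_finite)
    have "card (A \<inter> B) \<noteq> 2"
      using AB fin by (metis card_subset_eq inf_le1 inf_le2)
    moreover have "card (A \<inter> B) \<le> 2"
      using AB(3) fin by (metis card_mono inf_le1)
    ultimately have "card (A \<inter> B) = 0 \<or> card (A \<inter> B) = 1" by linarith
    then show "of_bool (case z of (A, B) \<Rightarrow> card (A \<inter> B) = 1) = (case z of (A, B) \<Rightarrow> card (A \<inter> B))"
      using z by auto
  qed
  also have "\<dots> = (\<Sum>v\<in>{1..n}. vdeg S v * vdeg ?T v)"
    using sum_vdeg_mult[OF S fin(2)] by (simp add: sum.cartesian_product)
  finally have "int (card (edge_boundary (johnson_graph n 2) S))
      = (\<Sum>v\<in>{1..n}. int (vdeg S v) * int (vdeg ?T v))" by simp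
  also have "\<dots> = (\<Sum>v\<in>{1..n}. (int n - 1) * int (vdeg S v) - int ((vdeg S v)\<^sup>2))"
  proof (intro sum.cong refl)
    fix v assume v: "v \<in> {1..n}"
    have "vdeg (pairs n) v = vdeg S v + vdeg ?T v"
      using sum.subset_diff[OF S finite_pairs, of "\<lambda>A. of_bool (v \<in> A)"] finite_pairs fin
      by (simp only: vdeg_eq_sum add.commute)
    moreover have "1 \<le> n" using v by simp
    ultimately have T: "int (vdeg ?T v) = int n - 1 - int (vdeg S v)"
      using vdeg_pairs[OF v] by linarith
    show "int (vdeg S v) * int (vdeg ?T v) = (int n - 1) * int (vdeg S v) - int ((vdeg S v)\<^sup>2)"
      unfolding T by (simp add: algebra_simps power2_eq_square)
  qed
  also have "\<dots> = (int n - 1) * int (\<Sum>v\<in>{1..n}. vdeg S v) - int (sumsq n S)"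
    by (simp add: sum_subtractf sum_distrib_left sumsq_def)
  finally show ?thesis
    unfolding sum_vdeg[OF S] by simp
qed

section \<open>Edge swaps and families maximizing the sum of squared degrees\<close>

text \<open>Only the degrees of \<open>u\<close> and \<open>v\<close> change, by \<open>+ 1\<close>
  and \<open>- 1\<close>, so the sum of squares grows by
  \<open>2 (vdeg S u - vdeg S v) + 2 > 0\<close>. The strict increase is what contradicts maximality
  later.\<close>

lemma sumsq_swap:
  assumes S: "S \<subseteq> pairs n"
    and wv: "{w, v} \<in> S" and wu: "{w, u} \<notin> S" "u \<noteq> w" "u \<in> {1..n}"
    and deg: "vdeg S v \<le> vdeg S u"
  defines "S' \<equiv> insert {w, u} (S - {{w, v}})"
  shows "S' \<subseteq> pairs n" and "card S' = card S" and "sumsq n S < sumsq n S'"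
proof -
  have fin: "finite S" using S by (rule finite_subset_pairs)
  have 2: "card {w, v} = 2" "{w, v} \<subseteq> {1..n}" using S wv by auto
  then have "w \<noteq> v" by auto
  have "u \<noteq> v" using wv wu by auto
  show "S' \<subseteq> pairs n" using S 2 wu by (auto simp: S'_def)
  show "card S' = card S"
    unfolding S'_def using fin wv wu card_gt_0_iff[of S] by auto
  have vd: "vdeg S' x + of_bool (x \<in> {w, v}) = vdeg S x + of_bool (x \<in> {w, u})" for x
    using fin wv wu
    by (simp add: S'_def vdeg_eq_sum sum.remove[OF fin wv, of "\<lambda>A. of_bool (x \<in> A)"])
  have split: "(\<Sum>x\<in>{1..n}. g x) = g u + (g v + (\<Sum>x\<in>{1..n} - {u} - {v}. g x))"
    for g :: "nat \<Rightarrow> nat"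
    using 2 wu(3) \<open>u \<noteq> v\<close>
    by (subst sum.remove[of _ u], simp, simp, subst sum.remove[of _ v]) auto
  have "vdeg S' u = vdeg S u + 1" "vdeg S v = vdeg S' v + 1"
    using vd[of u] vd[of v] \<open>u \<noteq> v\<close> \<open>w \<noteq> v\<close> wu(2) by auto
  moreover have "(\<Sum>x\<in>{1..n} - {u} - {v}. (vdeg S' x)\<^sup>2) = (\<Sum>x\<in>{1..n} - {u} - {v}. (vdeg S x)\<^sup>2)"
  proof (intro sum.cong refl)
    fix x assume "x \<in> {1..n} - {u} - {v}"
    then show "(vdeg S' x)\<^sup>2 = (vdeg S x)\<^sup>2" using vd[of x] by (cases "x = w") auto
  qed
  ultimately show "sumsq n S < sumsq n S'"
    unfolding sumsq_def split using deg by (simp add: power2_eq_square)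
qed

lemma ex_antimono_enumeration:
  fixes f :: "nat \<Rightarrow> nat"
  obtains p where "bij_betw p {..<n} {1..n}" "\<And>i j. i \<le> j \<Longrightarrow> j < n \<Longrightarrow> f (p j) \<le> f (p i)"
proof
  define xs where "xs = sort_key (\<lambda>v. - int (f v)) [1..<Suc n]"
  show "bij_betw ((!) xs) {..<n} {1..n}"
    by (rule bij_betw_nth) (auto simp: xs_def)
  show "f (xs ! j) \<le> f (xs ! i)" if "i \<le> j" "j < n" for i j
    using sorted_nth_mono[OF sorted_sort_key[of "\<lambda>v. - int (f v)" "[1..<Suc n]"], of i j] that
    by (simp add: xs_def)
qed

text \<open>Here \<open>s\<close> is the number of diagonal cells that turn the sorted adjacency
  matrix into a down-set. As \<open>s \<le> 2 sqrt (card S)\<close>, the extra term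
  \<open>k s\<close> is of lower order than \<open>2 k card S\<close> for large families.\<close>

lemma sumsq_maximal_le:
  assumes S: "S \<subseteq> pairs n" and pos: "0 < card S"
    and max: "\<And>S'. S' \<subseteq> pairs n \<Longrightarrow> card S' = card S \<Longrightarrow> sumsq n S' \<le> sumsq n S"
    and half: "4 * card S \<le> n * (n - 1)"
    and k: "n * (n + 1) \<le> 2 * k\<^sup>2" "4 * k \<le> 3 * n"
  shows "\<exists>s. sumsq n S \<le> k * (2 * card S + s) \<and> s\<^sup>2 \<le> 4 * card S"
proof -
  have fin: "finite S" using S by (rule finite_subset_pairs)
  obtain p where p: "bij_betw p {..<n} {1..n}"
    and mono: "\<And>i j. i \<le> j \<Longrightarrow> j < n \<Longrightarrow> vdeg S (p j) \<le> vdeg S (p i)"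
    using ex_antimono_enumeration[of n "vdeg S"] by blast
  have p_inj: "p i = p j \<longleftrightarrow> i = j" if "i < n" "j < n" for i j
    using p that by (auto simp: bij_betw_def inj_on_def)
  have p_in: "p i \<in> {1..n}" if "i < n" for i
    using p that by (auto simp: bij_betw_def)
  define R0 where "R0 = {(i, j). i < n \<and> j < n \<and> {p i, p j} \<in> S}"
  \<comment> \<open>Adjacency alone is not a down-set, as it misses the diagonal.\<close>
  define D where "D = (\<lambda>i. (i, i)) ` {i. \<exists>j>i. (i, j) \<in> R0}"
  define R where "R = R0 \<union> D"
  have ne: "i \<noteq> j" if "(i, j) \<in> R0" for i j
    using that S by (auto simp: R0_def)
  have sym0: "(j, i) \<in> R0" if "(i, j) \<in> R0" for i j
    using that by (auto simp: R0_def insert_commute)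
  \<comment> \<open>A gap \<open>(i, j')\<close> to the left of \<open>(i, j)\<close> could be
    filled by swapping \<open>{p i, p j}\<close> for \<open>{p i, p j'}\<close>, as
    \<open>p j'\<close> has at least the degree of \<open>p j\<close>; this would increase
    \<open>sumsq\<close>.\<close>
  have down0: "(i, j') \<in> R0" if "(i, j) \<in> R0" "j' \<le> j" "j' \<noteq> i" for i j j'
  proof (rule ccontr)
    assume n: "(i, j') \<notin> R0"
    have ij: "i < n" "j < n" "{p i, p j} \<in> S" "j' < n" using that by (auto simp: R0_def)
    then have "{p i, p j'} \<notin> S" "p j' \<noteq> p i" using n that(3) p_inj by (auto simp: R0_def)
    then have "sumsq n S < sumsq n (insert {p i, p j'} (S - {{p i, p j}}))"
      and "insert {p i, p j'} (S - {{p i, p j}}) \<subseteq> pairs n"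
      and "card (insert {p i, p j'} (S - {{p i, p j}})) = card S"
      using sumsq_swap[OF S ij(3), of "p j'"] p_in[OF ij(4)] mono[OF that(2) ij(2)] by auto
    then show False using max by (meson not_less)
  qed
  have R0n: "R0 \<subseteq> {..<n} \<times> {..<n}" by (auto simp: R0_def)
  have diag: "(i, i) \<in> R \<longleftrightarrow> (\<exists>j>i. (i, j) \<in> R0)" for i
    using ne by (auto simp: R_def D_def)
  have offdiag: "(i, j) \<in> R \<longleftrightarrow> (i, j) \<in> R0" if "i \<noteq> j" for i j
    using that by (auto simp: R_def D_def)
  interpret sym_downset R n
  proof
    show "R \<subseteq> {..<n} \<times> {..<n}" using R0n by (auto simp: R_def D_def)
    show "(y, x) \<in> R" if "(x, y) \<in> R" for x y
      using that sym0 offdiag by metis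
    show "(x, y') \<in> R" if xy: "(x, y) \<in> R" "y' \<le> y" for x y y'
    proof (cases "y' = y")
      case True
      then show ?thesis using that by simp
    next
      case lt: False
      \<comment> \<open>An off-diagonal cell is an edge itself, with \<open>j = y\<close>; a
        diagonal cell was added because of an edge further right in its row.\<close>
      have "\<exists>j\<ge>y. (x, j) \<in> R0"
        using xy(1) diag[of x] offdiag[of x y] by (cases "x = y") (auto intro: less_imp_le)
      then obtain j where j: "(x, j) \<in> R0" "y \<le> j" by blast
      show ?thesis
      proof (cases "y' = x")
        case True
        then have "x < j" using j lt that(2) by simp
        then show ?thesis using True diag j(1) by blast
      next
        case False
        then have "(x, y') \<in> R0" using down0 j that(2) by (meson le_trans)
        then show ?thesis by (simp add: R_def)
      qed
    qed
  qed
  have finR0: "finite R0" using finite_R by (simp add: R_def)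
  have row: "card (R0 `` {i}) = vdeg S (p i)" if i: "i \<in> {..<n}" for i
  proof -
    have "bij_betw (\<lambda>j. {p i, p j}) (R0 `` {i}) {A \<in> S. p i \<in> A}"
    proof (rule bij_betw_imageI)
      show "inj_on (\<lambda>j. {p i, p j}) (R0 `` {i})"
      proof (rule inj_onI)
        fix j j'
        assume "j \<in> R0 `` {i}" "j' \<in> R0 `` {i}" "{p i, p j} = {p i, p j'}"
        then have "j < n" "j' < n" "p j = p j'" by (auto simp: R0_def doubleton_eq_iff)
        then show "j = j'" using p_inj[of j j'] by simp
      qed
      show "(\<lambda>j. {p i, p j}) ` (R0 `` {i}) = {A \<in> S. p i \<in> A}"
      proof (intro equalityI subsetI)
        fix A assume A: "A \<in> {A \<in> S. p i \<in> A}"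
        then have "A \<subseteq> {1..n}" "card A = 2" using S by auto
        moreover obtain u where u: "A = {p i, u}"
          using card_2_mem[of A "p i"] A calculation by auto
        ultimately have "u \<in> {1..n}" by auto
        then have "u \<in> p ` {..<n}" using p by (simp only: bij_betw_def)
        then obtain j where "j < n" "u = p j" by blast
        then have "j \<in> R0 `` {i}" using A u i by (auto simp: R0_def)
        then show "A \<in> (\<lambda>j. {p i, p j}) ` (R0 `` {i})"
          by (rule rev_image_eqI) (simp add: u \<open>u = p j\<close>)
      qed (auto simp: R0_def)
    qed
    then show ?thesis unfolding vdeg_def by (rule bij_betw_same_card)
  qed
  have "card R0 = (\<Sum>i\<in>{..<n}. vdeg S (p i))"
    using weight_Image(2)[OF _ _ R0n] row by simp
  also have "\<dots> = 2 * card S"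
    using sum.reindex_bij_betw[OF p, of "vdeg S"] sum_vdeg[OF S] by simp
  finally have card0: "card R0 = 2 * card S" .
  define s where "s = card {i. (i, i) \<in> R}"
  have "{i. (i, i) \<in> R} = {i. \<exists>j>i. (i, j) \<in> R0}" using diag by auto
  then have "card D = s"
    unfolding D_def s_def by (simp add: card_image inj_on_def)
  moreover have "R0 \<inter> D = {}" using ne by (auto simp: D_def)
  moreover have "finite D" using finite_R by (simp add: R_def)
  ultimately have cardR: "card R = 2 * card S + s"
    using finR0 card0 by (simp add: R_def card_Un_disjoint)
  have "{i. (i, i) \<in> R} \<subseteq> {..<n}" using bounded by auto
  then have "s \<le> n" unfolding s_def using card_mono[of "{..<n}"] by fastforce
  have s2: "s\<^sup>2 \<le> 2 * card S + s"
    using diagonal_square_le cardR by (simp add: s_def)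
  \<comment> \<open>For \<open>s \<ge> 2\<close> one has \<open>s \<le> s^2 / 2\<close>, which
    absorbs the linear term of \<open>s2\<close>; for \<open>s \<le> 1\<close> it suffices that
    \<open>S\<close> is nonempty.\<close>
  have s4: "s\<^sup>2 \<le> 4 * card S"
  proof (cases "s \<le> 1")
    case True
    then have "s\<^sup>2 \<le> 1" using power_mono[of s 1 2] by simp
    then show ?thesis using pos by simp
  next
    case False
    then have "2 * s \<le> s\<^sup>2" by (simp add: power2_eq_square)
    then show ?thesis using s2 by simp
  qed
  \<comment> \<open>Indeed \<open>2 card R = 4 card S + 2s \<le> n (n - 1) + 2n = n (n + 1)\<close>:
    the diagonal accounts for \<open>n + 1\<close> in the hypothesis on \<open>k\<close>.\<close>
  have "2 * card R \<le> 2 * k\<^sup>2"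
  proof (cases n)
    case 0
    then show ?thesis using half pos by simp
  next
    case (Suc m)
    then show ?thesis using half cardR \<open>s \<le> n\<close> k(1) by simp
  qed
  then have "weight R \<le> int k * int (card R)"
    using k by (intro weight_le_card) (auto simp: power2_eq_square)
  moreover have "weight R0 \<le> weight R"
    unfolding weight_def R_def[symmetric] using finite_R
    by (intro sum_mono2) (auto simp: R_def)
  moreover have "int (sumsq n S) \<le> weight R0"
  proof -
    have "int (sumsq n S) = (\<Sum>i\<in>{..<n}. int (vdeg S (p i)) ^ 2)"
      using sum.reindex_bij_betw[OF p, of "\<lambda>v. (vdeg S v)\<^sup>2"] by (simp add: sumsq_def flip: of_nat_power of_nat_sum)
    \<comment> \<open>Rows of \<open>R0\<close> skip the diagonal and need not be initial segments,
      so the squared row length is only a lower bound for the row weight.\<close>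
    also have "\<dots> \<le> (\<Sum>i\<in>{..<n}. \<Sum>j\<in>R0 `` {i}. 2 * int j + 1)"
    proof (rule sum_mono)
      fix i assume "i \<in> {..<n}"
      then show "int (vdeg S (p i)) ^ 2 \<le> (\<Sum>j\<in>R0 `` {i}. 2 * int j + 1)"
        using row[of i] sum_square_le[of "R0 `` {i}"] finR0 by (simp add: finite_Image)
    qed
    also have "\<dots> = weight R0"
      using weight_Image(1)[OF _ _ R0n] by simp
    finally show ?thesis .
  qed
  ultimately have "int (sumsq n S) \<le> int (k * (2 * card S + s))"
    using cardR by simp
  then show ?thesis
    using s4 by (simp only: of_nat_le_iff) blast
qed

text \<open>Every degree is at most \<open>card S\<close>, and the degrees add up to
  \<open>2 card S\<close>. This serves small families, for which the diagonal term
  \<open>k s\<close> is not under control.\<close>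

lemma sumsq_le_trivial:
  assumes "S \<subseteq> pairs n"
  shows "sumsq n S \<le> card S * (2 * card S)"
proof -
  have "sumsq n S \<le> (\<Sum>v\<in>{1..n}. card S * vdeg S v)"
    unfolding sumsq_def power2_eq_square
    using finite_subset_pairs[OF assms]
    by (intro sum_mono mult_right_mono) (auto simp: vdeg_def intro: card_mono)
  then show ?thesis
    using sum_vdeg[OF assms] by (simp flip: sum_distrib_left)
qed

text \<open>The right-hand side depends on \<open>S\<close> only through its size, so for
  \<open>card S > k\<close> it is enough to bound a maximizer \<open>T\<close> of the same
  size.\<close>

lemma sumsq_le:
  assumes S: "S \<subseteq> pairs n" and half: "4 * card S \<le> n * (n - 1)"
    and k: "n * (n + 1) \<le> 2 * k\<^sup>2" "4 * k \<le> 3 * n"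
  shows "real (sumsq n S) \<le> (2 * real k + 2 * sqrt (real k)) * real (card S)"
proof (cases "card S \<le> k")
  case True
  have "real (sumsq n S) \<le> real (card S * (2 * card S))"
    using sumsq_le_trivial[OF S] by (simp only: of_nat_le_iff)
  also have "\<dots> \<le> (2 * real k + 2 * sqrt (real k)) * real (card S)"
    using True mult_right_mono[of "2 * real (card S)" "2 * real k + 2 * sqrt (real k)" "real (card S)"]
    by (simp add: add_increasing2 mult.commute)
  finally show ?thesis .
next
  case False
  let ?C = "{S'. S' \<subseteq> pairs n \<and> card S' = card S}"
  have "finite ?C"
    by (rule finite_subset[of _ "Pow (pairs n)"]) (use finite_pairs in auto)
  moreover have "S \<in> ?C" using S by simp
  ultimately have "Max (sumsq n ` ?C) \<in> sumsq n ` ?C" by (intro Max_in) blast+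
  then obtain T where T: "T \<in> ?C" and "Max (sumsq n ` ?C) = sumsq n T" by blast
  then have max: "sumsq n S' \<le> sumsq n T" if "S' \<in> ?C" for S'
    using Max_ge[OF finite_imageI[OF \<open>finite ?C\<close>] imageI[OF that], of "sumsq n"] by simp
  have cardT: "card T = card S" using T by simp
  have "\<exists>s. sumsq n T \<le> k * (2 * card T + s) \<and> s\<^sup>2 \<le> 4 * card T"
    using T max False half k by (intro sumsq_maximal_le) auto
  then obtain s where "sumsq n T \<le> k * (2 * card S + s)" and s2: "s\<^sup>2 \<le> 4 * card S"
    unfolding cardT by blast
  then have s: "sumsq n S \<le> k * (2 * card S + s)"
    using max[OF \<open>S \<in> ?C\<close>] by simp
  have "(real s)\<^sup>2 \<le> 4 * real (card S)"
    using of_nat_mono[OF s2, where 'a = real] by simp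
  then have "real s \<le> sqrt (4 * real (card S))" by (rule real_le_rsqrt)
  then have "real s \<le> 2 * sqrt (real (card S))" by (simp add: real_sqrt_mult)
  then have "real k * real s \<le> real k * (2 * sqrt (real (card S)))"
    by (intro mult_left_mono) auto
  also have "\<dots> = 2 * sqrt (real k) * (sqrt (real k) * sqrt (real (card S)))"
    by simp
  \<comment> \<open>One factor \<open>sqrt k\<close> is traded for \<open>sqrt (card S)\<close>,
    where \<open>k < card S\<close> enters; the error becomes proportional to
    \<open>card S\<close>.\<close>
  also have "\<dots> \<le> 2 * sqrt (real k) * (sqrt (real (card S)) * sqrt (real (card S)))"
    using False by (intro mult_left_mono mult_right_mono) auto
  finally have "real k * real s \<le> 2 * sqrt (real k) * real (card S)" by simp
  moreover have "real (sumsq n S) \<le> real k * (2 * real (card S) + real s)"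
    using of_nat_mono[OF s, where 'a = real] by simp
  ultimately show ?thesis by (simp add: algebra_simps)
qed

section \<open>The isoperimetric number\<close>

lemma iso_ratio_johnson:
  assumes "S \<subseteq> pairs n" "0 < card S"
  shows "real (card (edge_boundary (johnson_graph n 2) S)) / real (card S)
    = 2 * (real n - 1) - real (sumsq n S) / real (card S)"
proof -
  have "real_of_int (int (card (edge_boundary (johnson_graph n 2) S)))
      = real_of_int (2 * (int n - 1) * int (card S) - int (sumsq n S))"
    using card_edge_boundary_johnson[OF assms(1)] by simp
  then have "real (card (edge_boundary (johnson_graph n 2) S))
      = 2 * (real n - 1) * real (card S) - real (sumsq n S)" by simp
  then show ?thesis using assms(2) by (simp add: field_simps)
qed

lemma vertices_johnson_2: "vertices (johnson_graph n 2) = pairs n"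
  by (simp add: johnson_graph_def)

lemma iso_ratios_johnson_2:
  "iso_ratios (johnson_graph n 2) =
    {real (card (edge_boundary (johnson_graph n 2) S)) / real (card S) | S.
      S \<subseteq> pairs n \<and> 0 < card S \<and> real (card S) \<le> real (n choose 2) / 2}"
  using card_vertices_johnson[of n 2] unfolding iso_ratios_def vertices_johnson_2 by simp

lemma choose_2_real: "real (n choose 2) = real n * (real n - 1) / 2"
  by (cases n) (simp_all add: choose_two real_of_nat_div algebra_simps)

lemma finite_iso_ratios_johnson: "finite (iso_ratios (johnson_graph n 2))"
  using finite_pairs by (intro finite_iso_ratios) (simp add: vertices_johnson_2)

lemma isoperimetric_number_johnson_ge:
  assumes n: "3 \<le> n" and k: "n * (n + 1) \<le> 2 * k\<^sup>2" "4 * k \<le> 3 * n"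
  shows "2 * (real n - 1) - 2 * real k - 2 * sqrt (real k) \<le> isoperimetric_number (johnson_graph n 2)"
  unfolding isoperimetric_number_def
proof (rule Min.boundedI)
  show "finite (iso_ratios (johnson_graph n 2))"
    by (rule finite_iso_ratios_johnson)
  \<comment> \<open>From \<open>n = 3\<close> on there are at least three vertices, so the minimum
    is over a nonempty set.\<close>
  have "3 * 2 \<le> n * (n - 1)" using n by (intro mult_le_mono) auto
  then show "iso_ratios (johnson_graph n 2) \<noteq> {}"
    by (intro iso_ratios_nonempty) (simp add: card_vertices_johnson choose_two)
  fix r assume "r \<in> iso_ratios (johnson_graph n 2)"
  then obtain S where S: "S \<subseteq> pairs n" "0 < card S"
    and half: "real (card S) \<le> real (n choose 2) / 2"
    and r: "r = real (card (edge_boundary (johnson_graph n 2) S)) / real (card S)"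
    unfolding iso_ratios_johnson_2 by blast
  have "real (4 * card S) \<le> real (n * (n - 1))"
    using half n by (simp add: choose_2_real of_nat_diff)
  then have "real (sumsq n S) \<le> (2 * real k + 2 * sqrt (real k)) * real (card S)"
    using S k by (intro sumsq_le) (simp_all only: of_nat_le_iff)
  then have "real (sumsq n S) / real (card S) \<le> 2 * real k + 2 * sqrt (real k)"
    using S(2) by (simp add: pos_divide_le_eq)
  then show "2 * (real n - 1) - 2 * real k - 2 * sqrt (real k) \<le> r"
    unfolding r iso_ratio_johnson[OF S] by simp
qed

text \<open>The witness is the clique \<open>pairs m\<close>: it has \<open>m (m - 1) / 2\<close>
  edges and \<open>m\<close> points of degree \<open>m - 1\<close>, so the squared degrees per edge
  come to \<open>2 (m - 1)\<close>. The last assumption says that it contains at most half of the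
  vertices.\<close>

lemma isoperimetric_number_johnson_le:
  assumes m: "2 \<le> m" "m \<le> n" "2 * (m * (m - 1)) \<le> n * (n - 1)"
  shows "isoperimetric_number (johnson_graph n 2) \<le> 2 * (real n - real m)"
proof -
  let ?S = "pairs m"
  have S: "?S \<subseteq> pairs n" using m by auto
  have card: "real (card ?S) = real m * (real m - 1) / 2"
    using n_subsets[of "{1..m}" 2] by (simp add: choose_2_real)
  have "0 < real m * (real m - 1) / 2" using m by simp
  then have pos: "0 < card ?S" by (simp only: flip: card of_nat_0_less_iff[where 'a = real])
  have "vdeg ?S v = (if v \<in> {1..m} then m - 1 else 0)" if "v \<in> {1..n}" for v
    using vdeg_pairs[of v m] by (auto simp: vdeg_def)
  then have "sumsq n ?S = (\<Sum>v\<in>{1..n}. if v \<in> {1..m} then (m - 1)\<^sup>2 else 0)"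
    unfolding sumsq_def by (intro sum.cong) auto
  also have "\<dots> = (\<Sum>v\<in>{1..n} \<inter> {1..m}. (m - 1)\<^sup>2)"
    by (rule sum.inter_restrict[symmetric]) simp
  also have "{1..n} \<inter> {1..m} = {1..m}" using m by auto
  finally have "real (sumsq n ?S) = real m * (real m - 1)\<^sup>2"
    using m by (simp add: of_nat_diff)
  then have "real (sumsq n ?S) = 2 * (real m - 1) * real (card ?S)"
    unfolding card by (simp add: power2_eq_square)
  moreover have "real (card ?S) \<noteq> 0"
    by (metis pos less_irrefl of_nat_eq_0_iff)
  ultimately have "real (sumsq n ?S) / real (card ?S) = 2 * (real m - 1)"
    by (rule nonzero_divide_eq_eq[THEN iffD2, rotated])
  then have "real (card (edge_boundary (johnson_graph n 2) ?S)) / real (card ?S)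
      = 2 * (real n - real m)"
    unfolding iso_ratio_johnson[OF S pos] by simp
  moreover have "real (card ?S) \<le> real (n choose 2) / 2"
  proof -
    have "real (2 * (m * (m - 1))) \<le> real (n * (n - 1))"
      using m(3) by (simp only: of_nat_le_iff)
    then show ?thesis using card m by (simp add: choose_2_real of_nat_diff)
  qed
  ultimately have "2 * (real n - real m) \<in> iso_ratios (johnson_graph n 2)"
    unfolding iso_ratios_johnson_2
    using S pos by (intro CollectI exI[of _ ?S] conjI) (simp_all only:)
  then show ?thesis
    unfolding isoperimetric_number_def by (intro Min_le finite_iso_ratios_johnson)
qed

section \<open>Rounding and the limit\<close>

lemma isoperimetric_number_johnson_bounds:
  assumes n: "100 \<le> n"
  shows "(2 - sqrt 2) * real n - 6 - 2 * sqrt (real n) \<le> isoperimetric_number (johnson_graph n 2)"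
    and "isoperimetric_number (johnson_graph n 2) \<le> (2 - sqrt 2) * real n + 2"
proof -
  define x where "x = real n * sqrt 2 / 2"
  have x2: "2 * x\<^sup>2 = (real n)\<^sup>2" by (simp add: x_def power_mult_distrib power_divide)
  have "14 / 10 \<le> sqrt (2 :: real)" by (rule real_le_rsqrt) (simp add: power2_eq_square)
  then have "real n * (14 / 10) \<le> real n * sqrt 2" by (intro mult_left_mono) auto
  then have x_ge: "7 / 10 * real n \<le> x" by (simp add: x_def)
  have "sqrt (2 :: real) \<le> 142 / 100" by (rule real_le_lsqrt) (simp_all add: power2_eq_square)
  then have "real n * sqrt 2 \<le> real n * (142 / 100)" by (intro mult_left_mono) auto
  then have x_le: "x \<le> 71 / 100 * real n" by (simp add: x_def)

  \<comment> \<open>The extra \<open>+ 1\<close> gives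
    \<open>2k^2 \<ge> 2 (x + 1)^2 = n^2 + 4x + 2\<close>, which covers \<open>n (n + 1)\<close>. As
    \<open>k \<le> 0.71 n + 2\<close>, a large \<open>n\<close> leaves room for
    \<open>4k \<le> 3n\<close>. The constant 6 is 2 from \<open>2 (n - 1)\<close> plus 4 from
    \<open>2k \<le> 2x + 4\<close>.\<close>
  define k where "k = nat \<lceil>x\<rceil> + 1"
  have k: "x + 1 \<le> real k" "real k \<le> x + 2"
    using x_ge n by (simp_all add: k_def) linarith+
  have "real (n * (n + 1)) \<le> 2 * (x + 1)\<^sup>2"
    using x2 x_ge by (simp add: power2_eq_square algebra_simps)
  also have "\<dots> \<le> real (2 * k\<^sup>2)"
    using k(1) x_ge by (simp add: power_mono)
  finally have "n * (n + 1) \<le> 2 * k\<^sup>2" by (simp only: of_nat_le_iff)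
  moreover have k34: "4 * k \<le> 3 * n"
  proof -
    have "4 * real k \<le> 3 * real n" using k(2) x_le n by linarith
    then show ?thesis by linarith
  qed
  ultimately have "2 * (real n - 1) - 2 * real k - 2 * sqrt (real k)
      \<le> isoperimetric_number (johnson_graph n 2)"
    using n by (intro isoperimetric_number_johnson_ge) auto
  moreover have "sqrt (real k) \<le> sqrt (real n)" using k34 by simp
  moreover have "2 * real k \<le> real n * sqrt 2 + 4" using k(2) by (simp add: x_def)
  ultimately have "2 * real n - real n * sqrt 2 - 6 - 2 * sqrt (real n)
      \<le> isoperimetric_number (johnson_graph n 2)" by argo
  then show "(2 - sqrt 2) * real n - 6 - 2 * sqrt (real n) \<le> isoperimetric_number (johnson_graph n 2)"
    by (simp add: algebra_simps)

  \<comment> \<open>Rounding down keeps \<open>2m^2 \<le> n^2\<close>; together with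
    \<open>n \<le> 2m\<close> this yields \<open>2m (m - 1) \<le> n (n - 1)\<close>, the size
    condition on the clique. The loss \<open>m \<ge> x - 1\<close> produces the constant 2.\<close>
  define m where "m = nat \<lfloor>x\<rfloor>"
  have "real m = of_int \<lfloor>x\<rfloor>" using x_ge n by (simp add: m_def)
  then have m: "real m \<le> x" "x - 1 \<le> real m" by linarith+
  have m2: "2 \<le> m" "m \<le> n" "n \<le> 2 * m"
  proof -
    have "2 \<le> real m" "real m \<le> real n" "real n \<le> 2 * real m" using m x_ge x_le n by simp_all
    then show "2 \<le> m" "m \<le> n" "n \<le> 2 * m" by linarith+
  qed
  have "2 * (real m)\<^sup>2 \<le> 2 * x\<^sup>2" using m(1) by (simp add: power_mono)
  then have "2 * (real m * (real m - 1)) \<le> real n * (real n - 1)"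
    using x2 m2 by (simp add: power2_eq_square algebra_simps)
  then have "real (2 * (m * (m - 1))) \<le> real (n * (n - 1))"
    using m2 n by (simp add: of_nat_diff)
  then have "isoperimetric_number (johnson_graph n 2) \<le> 2 * (real n - real m)"
    using m2 by (intro isoperimetric_number_johnson_le) (simp_all only: of_nat_le_iff)
  then show "isoperimetric_number (johnson_graph n 2) \<le> (2 - sqrt 2) * real n + 2"
    using m(2) by (simp add: x_def algebra_simps)
qed

theorem theorem2:
  shows "(\<lambda>n::nat. isoperimetric_number (johnson_graph n 2) / ((2 - sqrt 2) * real n)) \<longlonglongrightarrow> 1"
proof (rule tendsto_sandwich)
  have c: "0 < 2 - sqrt (2 :: real)"
    using sqrt2_less_2 by simp
  \<comment> \<open>The error terms are \<open>o(n)\<close>, so both quotients tend to 1 for any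
    \<open>c > 0\<close>; below, \<open>c\<close> is \<open>2 - sqrt 2\<close>.\<close>
  have lim: "(\<lambda>n. (c * real n - 6 - 2 * sqrt (real n)) / (c * real n)) \<longlonglongrightarrow> 1"
    "(\<lambda>n. (c * real n + 2) / (c * real n)) \<longlonglongrightarrow> 1" if "0 < c" for c
    using that by real_asymp+
  show "\<forall>\<^sub>F n in sequentially. ((2 - sqrt 2) * real n - 6 - 2 * sqrt (real n)) / ((2 - sqrt 2) * real n)
      \<le> isoperimetric_number (johnson_graph n 2) / ((2 - sqrt 2) * real n)"
    using eventually_ge_at_top[of 100]
    by eventually_elim (use isoperimetric_number_johnson_bounds(1) c in \<open>simp add: divide_right_mono\<close>)
  show "\<forall>\<^sub>F n in sequentially. isoperimetric_number (johnson_graph n 2) / ((2 - sqrt 2) * real n)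
      \<le> ((2 - sqrt 2) * real n + 2) / ((2 - sqrt 2) * real n)"
    using eventually_ge_at_top[of 100]
    by eventually_elim (use isoperimetric_number_johnson_bounds(2) c in \<open>simp add: divide_right_mono\<close>)
  show "(\<lambda>n. ((2 - sqrt 2) * real n - 6 - 2 * sqrt (real n)) / ((2 - sqrt 2) * real n)) \<longlonglongrightarrow> 1"
    using c by (rule lim)
  show "(\<lambda>n. ((2 - sqrt 2) * real n + 2) / ((2 - sqrt 2) * real n)) \<longlonglongrightarrow> 1"
    using c by (rule lim)
qed

end
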